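(* Let $T$ be a complete first-order theory and let $\varphi(x,y)$ and $\psi(x,z)$ be formulas. If the formula $\varphi(x,y)\vee\psi(x,z)$ (with object variables $x$ and parameter variables $yz$) witnesses ATP, then $\varphi(x,y)$ witnesses ATP or $\psi(x,z)$ witnesses ATP.
   Context: Let $\mathbb{M}$ be a monster model of $T$. $2^{<\omega}$ is the set of finite $0/1$-strings; $\eta\trianglelefteq\nu$ means that $\eta$ is an initial segment of $\nu$. An antichain is a set of pairwise $\trianglelefteq$-incomparable elements. A formula $\theta(x,w)$ has (witnesses) the antichain tree property (ATP) if there is a family $(a_\eta)_{\eta\in 2^{<\omega}}$ of parameters in $\mathbb{M}$ such that (i) for every antichain $X\subseteq 2^{<\omega}$ the set $\{\theta(x,a_\eta):\eta\in X\}$ is consistent, and (ii) for all $\eta\trianglelefteq\nu$ in $2^{<\omega}$ with $\eta\neq\nu$, the set $\{\theta(x,a_\eta),\theta(x,a_\nu)\}$ is inconsistent. *)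

theory Defs
  imports Main "HOL-Library.Sublist"
begin

unbundle cardinal_syntax

section \<open>First-order syntax\<close>

record ('f, 'p) language =
  funs :: "'f set"
  rels :: "'p set"
  far :: "'f \<Rightarrow> nat"
  rar :: "'p \<Rightarrow> nat"

datatype 'f tm = Var nat | Fn 'f "'f tm list"

datatype ('f, 'p) fm =
    Eq "'f tm" "'f tm"
  | Rel 'p "'f tm list"
  | Neg "('f, 'p) fm"
  | Disj "('f, 'p) fm" "('f, 'p) fm"
  | Ex nat "('f, 'p) fm"

fun vars :: "'f tm \<Rightarrow> nat set" where
  "vars (Var v) = {v}"
| "vars (Fn f ts) = (\<Union>t\<in>set ts. vars t)"

fun fv :: "('f, 'p) fm \<Rightarrow> nat set" where
  "fv (Eq t u) = vars t \<union> vars u"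
| "fv (Rel p ts) = (\<Union>t\<in>set ts. vars t)"
| "fv (Neg \<phi>) = fv \<phi>"
| "fv (Disj \<phi> \<psi>) = fv \<phi> \<union> fv \<psi>"
| "fv (Ex v \<phi>) = fv \<phi> - {v}"

fun term_of :: "('f, 'p) language \<Rightarrow> 'f tm \<Rightarrow> bool" where
  "term_of L (Var v) \<longleftrightarrow> True"
| "term_of L (Fn f ts) \<longleftrightarrow> f \<in> funs L \<and> length ts = far L f \<and> (\<forall>t\<in>set ts. term_of L t)"

fun formula_of :: "('f, 'p) language \<Rightarrow> ('f, 'p) fm \<Rightarrow> bool" where
  "formula_of L (Eq t u) \<longleftrightarrow> term_of L t \<and> term_of L u"
| "formula_of L (Rel p ts) \<longleftrightarrow> p \<in> rels L \<and> length ts = rar L p \<and> (\<forall>t\<in>set ts. term_of L t)"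
| "formula_of L (Neg \<phi>) \<longleftrightarrow> formula_of L \<phi>"
| "formula_of L (Disj \<phi> \<psi>) \<longleftrightarrow> formula_of L \<phi> \<and> formula_of L \<psi>"
| "formula_of L (Ex v \<phi>) \<longleftrightarrow> formula_of L \<phi>"

definition sentences :: "('f, 'p) language \<Rightarrow> ('f, 'p) fm set" where
  "sentences L = {\<sigma>. formula_of L \<sigma> \<and> fv \<sigma> = {}}"

section \<open>Structures and satisfaction\<close>

record ('f, 'p, 'm) interp =
  univ :: "'m set"
  fint :: "'f \<Rightarrow> 'm list \<Rightarrow> 'm"
  rint :: "'p \<Rightarrow> 'm list \<Rightarrow> bool"

definition is_structure :: "('f, 'p) language \<Rightarrow> ('f, 'p, 'm) interp \<Rightarrow> bool" where
  "is_structure L M \<longleftrightarrow> univ M \<noteq> {} \<and>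
     (\<forall>f\<in>funs L. \<forall>as. length as = far L f \<and> set as \<subseteq> univ M \<longrightarrow> fint M f as \<in> univ M)"

fun eval_tm :: "('f, 'p, 'm) interp \<Rightarrow> (nat \<Rightarrow> 'm) \<Rightarrow> 'f tm \<Rightarrow> 'm" where
  "eval_tm M s (Var v) = s v"
| "eval_tm M s (Fn f ts) = fint M f (map (eval_tm M s) ts)"

fun sat :: "('f, 'p, 'm) interp \<Rightarrow> (nat \<Rightarrow> 'm) \<Rightarrow> ('f, 'p) fm \<Rightarrow> bool" where
  "sat M s (Eq t u) \<longleftrightarrow> eval_tm M s t = eval_tm M s u"
| "sat M s (Rel p ts) \<longleftrightarrow> rint M p (map (eval_tm M s) ts)"
| "sat M s (Neg \<phi>) \<longleftrightarrow> \<not> sat M s \<phi>"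
| "sat M s (Disj \<phi> \<psi>) \<longleftrightarrow> sat M s \<phi> \<or> sat M s \<psi>"
| "sat M s (Ex v \<phi>) \<longleftrightarrow> (\<exists>m\<in>univ M. sat M (s(v := m)) \<phi>)"

definition is_model :: "('f, 'p) language \<Rightarrow> ('f, 'p) fm set \<Rightarrow> ('f, 'p, 'm) interp \<Rightarrow> bool" where
  "is_model L T M \<longleftrightarrow> is_structure L M \<and> (\<forall>\<sigma>\<in>T. \<forall>s. sat M s \<sigma>)"

section \<open>Complete theories\<close>

text \<open>HOL cannot quantify over structures of all types, so consistency and consequence refer to
  structures whose universe is a set of formulas.  There are as many formulas as symbols, and at
  least countably many, so by the downward Loewenheim-Skolem theorem this is no restriction; the
  lemmas \<open>entails_imp_sat\<close> and \<open>is_model_imp_satisfiable\<close> below confirm it.\<close>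

definition satisfiable :: "('f, 'p) language \<Rightarrow> ('f, 'p) fm set \<Rightarrow> bool" where
  "satisfiable L T \<longleftrightarrow> (\<exists>N :: ('f, 'p, ('f, 'p) fm) interp. is_model L T N)"

definition entails :: "('f, 'p) language \<Rightarrow> ('f, 'p) fm set \<Rightarrow> ('f, 'p) fm \<Rightarrow> bool" where
  "entails L T \<sigma> \<longleftrightarrow>
     (\<forall>N :: ('f, 'p, ('f, 'p) fm) interp. is_model L T N \<longrightarrow> (\<forall>s. sat N s \<sigma>))"

definition complete_theory :: "('f, 'p) language \<Rightarrow> ('f, 'p) fm set \<Rightarrow> bool" where
  "complete_theory L T \<longleftrightarrow> T \<subseteq> sentences L \<and> satisfiable L T \<and>
     (\<forall>\<sigma>\<in>sentences L. entails L T \<sigma> \<or> entails L T (Neg \<sigma>))"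

lemma finite_vars: "finite (vars t)"
  by (induction t) auto

lemma finite_fv: "finite (fv \<phi>)"
  by (induction \<phi>) (auto simp: finite_vars)

lemma eval_tm_cong: "(\<And>v. v \<in> vars t \<Longrightarrow> s v = s' v) \<Longrightarrow> eval_tm M s t = eval_tm M s' t"
proof (induction t)
  case (Fn f ts)
  have "map (eval_tm M s) ts = map (eval_tm M s') ts"
    by (rule map_cong[OF refl], rule Fn.IH) (use Fn.prems in auto)
  then show ?case by (simp only: eval_tm.simps)
qed simp

lemma sat_cong: "(\<And>v. v \<in> fv \<phi> \<Longrightarrow> s v = s' v) \<Longrightarrow> sat M s \<phi> \<longleftrightarrow> sat M s' \<phi>"
proof (induction \<phi> arbitrary: s s')
  case (Eq t u)
  then show ?case using eval_tm_cong[of t s s' M] eval_tm_cong[of u s s' M] by auto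
next
  case (Rel p ts)
  have "map (eval_tm M s) ts = map (eval_tm M s') ts"
    by (rule map_cong[OF refl], rule eval_tm_cong) (use Rel in auto)
  then show ?case by (simp only: sat.simps)
next
  case (Neg \<phi>)
  then have "sat M s \<phi> \<longleftrightarrow> sat M s' \<phi>" by (intro Neg.IH) auto
  then show ?case by simp
next
  case (Disj \<phi> \<psi>)
  have "sat M s \<phi> \<longleftrightarrow> sat M s' \<phi>" by (rule Disj.IH(1)) (simp add: Disj.prems)
  moreover have "sat M s \<psi> \<longleftrightarrow> sat M s' \<psi>" by (rule Disj.IH(2)) (simp add: Disj.prems)
  ultimately show ?case by simp
next
  case (Ex v \<phi>)
  have "sat M (s(v := m)) \<phi> \<longleftrightarrow> sat M (s'(v := m)) \<phi>" for m
    using Ex.prems by (intro Ex.IH) auto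
  then show ?case by simp
qed

definition env :: "'m \<Rightarrow> 'm list \<Rightarrow> nat \<Rightarrow> 'm" where
  "env d ms v = (if v < length ms then ms ! v else d)"

definition skolem :: "('f, 'p, 'm) interp \<Rightarrow> 'm \<Rightarrow> ('f, 'p) fm \<Rightarrow> nat \<Rightarrow> 'm list \<Rightarrow> 'm" where
  "skolem M d \<phi> v ms = (if \<exists>m\<in>univ M. sat M ((env d ms)(v := m)) \<phi>
     then SOME m. m \<in> univ M \<and> sat M ((env d ms)(v := m)) \<phi> else d)"

text \<open>Formulas serve as codes for the elements of a Skolem hull.\<close>

function (sequential) decode :: "('f, 'p, 'm) interp \<Rightarrow> 'm \<Rightarrow> ('f, 'p) fm \<Rightarrow> 'm"
  and decodes :: "('f, 'p, 'm) interp \<Rightarrow> 'm \<Rightarrow> ('f, 'p) fm \<Rightarrow> 'm list" where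
  "decode M d (Ex v (Disj \<phi> l)) = skolem M d \<phi> v (decodes M d l)"
| "decode M d _ = d"
| "decodes M d (Disj a l) = decode M d a # decodes M d l"
| "decodes M d _ = []"
  by pat_completeness auto
termination by size_change

lemma skolem_wit:
  assumes "m \<in> univ M" "sat M ((env d ms)(v := m)) \<phi>"
  shows "skolem M d \<phi> v ms \<in> univ M \<and> sat M ((env d ms)(v := skolem M d \<phi> v ms)) \<phi>"
proof -
  have ex: "\<exists>m. m \<in> univ M \<and> sat M ((env d ms)(v := m)) \<phi>" using assms by blast
  then have "skolem M d \<phi> v ms = (SOME m. m \<in> univ M \<and> sat M ((env d ms)(v := m)) \<phi>)"
    unfolding skolem_def by (subst if_P) blast+
  with someI_ex[OF ex] show ?thesis by (simp only:)
qed

lemma skolem_in: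
  assumes "d \<in> univ M"
  shows "skolem M d \<phi> v ms \<in> univ M"
proof (cases "\<exists>m\<in>univ M. sat M ((env d ms)(v := m)) \<phi>")
  case True
  then obtain m where "m \<in> univ M" "sat M ((env d ms)(v := m)) \<phi>" by blast
  from skolem_wit[OF this] show ?thesis ..
next
  case False
  then show ?thesis using assms unfolding skolem_def by (subst if_not_P)
qed

lemma decode_in:
  assumes "d \<in> univ M"
  shows "decode M d a \<in> univ M"
proof (cases a)
  case (Ex v \<phi>)
  then show ?thesis using assms by (cases \<phi>) (simp_all add: skolem_in)
qed (use assms in simp_all)

lemma skolem_decode:
  assumes "set ms \<subseteq> range (decode M d)"
  shows "skolem M d \<phi> v ms \<in> range (decode M d)"
proof -
  have "\<exists>l. decodes M d l = ms" using assms
  proof (induction ms)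
    case Nil
    have "decodes M d (Eq (Var 0) (Var 0)) = []" by simp
    then show ?case by blast
  next
    case (Cons m ms)
    then obtain a l where "m = decode M d a" "decodes M d l = ms" by auto
    then have "decodes M d (Disj a l) = m # ms" by simp
    then show ?case by blast
  qed
  then obtain l where "decodes M d l = ms" ..
  then have "decode M d (Ex v (Disj \<phi> l)) = skolem M d \<phi> v ms" by simp
  then show ?thesis by (metis rangeI)
qed

lemma downward_Loewenheim_Skolem:
  fixes L :: "('f, 'p) language" and M :: "('f, 'p, 'm) interp"
  assumes M: "is_structure L M"
  obtains N :: "('f, 'p, ('f, 'p) fm) interp" where "is_structure L N"
    and "\<And>\<sigma> s s'. \<sigma> \<in> sentences L \<Longrightarrow> sat N s \<sigma> \<longleftrightarrow> sat M s' \<sigma>"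
proof -
  obtain d where d: "d \<in> univ M" using M by (auto simp: is_structure_def)
  define h where "h = (decode M d :: ('f, 'p) fm \<Rightarrow> 'm)"
  define g where "g = inv h"
  have hg: "h (g m) = m" if "m \<in> range h" for m
    using that by (simp add: g_def f_inv_into_f)
  have hM: "h a \<in> univ M" for a using decode_in[OF d] by (simp add: h_def)
  have sk: "skolem M d \<phi> v ms \<in> range h" if "set ms \<subseteq> range h" for \<phi> :: "('f, 'p) fm" and v ms
    using that unfolding h_def by (rule skolem_decode)
  have closed: "fint M f ms \<in> range h"
    if "f \<in> funs L" "length ms = far L f" "set ms \<subseteq> range h" for f ms
  proof -
    let ?n = "length ms"
    let ?\<phi> = "Eq (Fn f (map Var [0..<?n])) (Var ?n) :: ('f, 'p) fm"
    have in_M: "fint M f ms \<in> univ M"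
    proof -
      have "set ms \<subseteq> univ M" using that(3) hM by auto
      then show ?thesis using M that(1,2) by (simp add: is_structure_def)
    qed
    have map: "map (eval_tm M ((env d ms)(?n := m)) \<circ> Var) [0..<?n] = ms" for m
      by (rule nth_equalityI) (auto simp: env_def)
    have "sat M ((env d ms)(?n := fint M f ms)) ?\<phi>" by (simp add: map)
    then have "sat M ((env d ms)(?n := skolem M d ?\<phi> ?n ms)) ?\<phi>" by (rule skolem_wit[OF in_M, THEN conjunct2])
    then have "skolem M d ?\<phi> ?n ms = fint M f ms" by (simp add: map)
    then show ?thesis using sk[OF that(3), of ?\<phi> ?n] by simp
  qed
  define N where "N = \<lparr>univ = g ` range h, fint = (\<lambda>f as. g (fint M f (map h as))),
    rint = (\<lambda>p as. rint M p (map h as))\<rparr>"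
  have gh: "g (h a) = a" if "a \<in> univ N" for a
    using that hg by (auto simp: N_def)
  have strN: "is_structure L N"
    unfolding is_structure_def
  proof (intro conjI ballI allI impI)
    show "univ N \<noteq> {}" by (simp add: N_def)
  next
    fix f as assume "f \<in> funs L" "length as = far L f \<and> set as \<subseteq> univ N"
    then have "fint M f (map h as) \<in> range h" by (intro closed) auto
    then show "fint N f as \<in> univ N" by (simp add: N_def)
  qed
  have ev: "eval_tm N s t \<in> univ N \<and> h (eval_tm N s t) = eval_tm M (h \<circ> s) t"
    if "term_of L t" "range s \<subseteq> univ N" for s t
    using that
  proof (induction t)
    case (Var v)
    then show ?case by auto
  next
    case (Fn f ts)
    have IH: "eval_tm N s t \<in> univ N \<and> h (eval_tm N s t) = eval_tm M (h \<circ> s) t"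
      if "t \<in> set ts" for t
    proof -
      have "term_of L t" using Fn.prems(1) that by simp
      then show ?thesis by (rule Fn.IH[OF that _ Fn.prems(2)])
    qed
    have eq: "map h (map (eval_tm N s) ts) = map (eval_tm M (h \<circ> s)) ts"
      using IH by simp
    have "fint M f (map h (map (eval_tm N s) ts)) \<in> range h"
      using Fn.prems by (intro closed) auto
    then have "g (fint M f (map (eval_tm M (h \<circ> s)) ts)) \<in> univ N"
      "h (g (fint M f (map (eval_tm M (h \<circ> s)) ts))) = fint M f (map (eval_tm M (h \<circ> s)) ts)"
      unfolding eq by (simp_all add: N_def hg)
    moreover have "eval_tm N s (Fn f ts) = g (fint M f (map (eval_tm M (h \<circ> s)) ts))"
      unfolding eval_tm.simps eq[symmetric] by (simp add: N_def)
    ultimately show ?case by (simp only: eval_tm.simps)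
  qed
  have sat: "sat N s \<phi> \<longleftrightarrow> sat M (h \<circ> s) \<phi>"
    if "formula_of L \<phi>" "range s \<subseteq> univ N" for s \<phi>
    using that
  proof (induction \<phi> arbitrary: s)
    case (Eq t u)
    then have "term_of L t" "term_of L u" by simp_all
    note ev[OF this(1) Eq.prems(2)] ev[OF this(2) Eq.prems(2)]
    then show ?case unfolding sat.simps by (metis gh)
  next
    case (Rel p ts)
    have "h (eval_tm N s t) = eval_tm M (h \<circ> s) t" if "t \<in> set ts" for t
      using ev[OF _ Rel.prems(2)] Rel.prems(1) that by (metis formula_of.simps(2))
    then have "map h (map (eval_tm N s) ts) = map (eval_tm M (h \<circ> s)) ts"
      by simp
    moreover have "rint N p as \<longleftrightarrow> rint M p (map h as)" for as
      by (simp add: N_def)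
    ultimately show ?case by (simp only: sat.simps)
  next
    case (Ex v \<phi>)
    have IH: "sat N (s(v := a)) \<phi> \<longleftrightarrow> sat M ((h \<circ> s)(v := h a)) \<phi>" if "a \<in> univ N" for a
    proof -
      have "range (s(v := a)) \<subseteq> univ N" using Ex.prems(2) that by (simp add: image_subset_iff)
      moreover have "formula_of L \<phi>" using Ex.prems(1) by simp
      ultimately have "sat N (s(v := a)) \<phi> \<longleftrightarrow> sat M (h \<circ> s(v := a)) \<phi>" by (intro Ex.IH)
      then show ?thesis by (simp add: fun_upd_comp)
    qed
    show ?case
    proof
      assume "sat N s (Ex v \<phi>)"
      then obtain a where "a \<in> univ N" "sat N (s(v := a)) \<phi>" by auto
      then have "sat M ((h \<circ> s)(v := h a)) \<phi>" using IH by blast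
      then show "sat M (h \<circ> s) (Ex v \<phi>)" unfolding sat.simps using hM by blast
    next
      assume "sat M (h \<circ> s) (Ex v \<phi>)"
      then obtain m where m: "m \<in> univ M" "sat M ((h \<circ> s)(v := m)) \<phi>" by auto
      obtain k where k: "\<And>i. i \<in> fv \<phi> \<Longrightarrow> i < k"
        using finite_fv[of \<phi>] by (meson finite_nat_set_iff_bounded)
      let ?ms = "map (h \<circ> s) [0..<k]"
      let ?m = "skolem M d \<phi> v ?ms"
      have agree: "sat M ((env d ?ms)(v := x)) \<phi> \<longleftrightarrow> sat M ((h \<circ> s)(v := x)) \<phi>" for x
        by (rule sat_cong) (auto simp: env_def k)
      have "sat M ((h \<circ> s)(v := ?m)) \<phi>"
        using skolem_wit[OF m(1)] m(2) agree by blast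
      moreover have "?m \<in> range h" by (rule sk) auto
      ultimately have "g ?m \<in> univ N" "sat M ((h \<circ> s)(v := h (g ?m))) \<phi>"
        by (simp_all add: N_def hg)
      then show "sat N s (Ex v \<phi>)" unfolding sat.simps using IH by blast
    qed
  next
    case (Neg \<phi>)
    then show ?case by (simp only: sat.simps formula_of.simps)
  next
    case (Disj \<phi> \<psi>)
    then show ?case by (simp only: sat.simps formula_of.simps)
  qed
  have "sat N s \<sigma> \<longleftrightarrow> sat M s' \<sigma>" if \<sigma>: "\<sigma> \<in> sentences L" for \<sigma> s s'
  proof -
    obtain a where a: "a \<in> univ N" using strN by (auto simp: is_structure_def)
    have "sat N s \<sigma> \<longleftrightarrow> sat N (\<lambda>_. a) \<sigma>" by (rule sat_cong) (use \<sigma> in \<open>auto simp: sentences_def\<close>)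
    also have "\<dots> \<longleftrightarrow> sat M (h \<circ> (\<lambda>_. a)) \<sigma>" by (rule sat) (use \<sigma> a in \<open>auto simp: sentences_def\<close>)
    also have "\<dots> \<longleftrightarrow> sat M s' \<sigma>" by (rule sat_cong) (use \<sigma> in \<open>auto simp: sentences_def\<close>)
    finally show ?thesis .
  qed
  with strN show thesis by (rule that)
qed

lemma entails_imp_sat:
  fixes M :: "('f, 'p, 'm) interp"
  assumes "entails L T \<sigma>" "T \<subseteq> sentences L" "\<sigma> \<in> sentences L" "is_model L T M"
  shows "sat M s \<sigma>"
proof -
  obtain N :: "('f, 'p, ('f, 'p) fm) interp" where N: "is_structure L N"
    "\<And>\<sigma> s s'. \<sigma> \<in> sentences L \<Longrightarrow> sat N s \<sigma> \<longleftrightarrow> sat M s' \<sigma>"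
    using downward_Loewenheim_Skolem assms(4) unfolding is_model_def by blast
  have "is_model L T N" using N(1) N(2) assms(2,4) unfolding is_model_def by (meson subsetD)
  then have "sat N (\<lambda>_. undefined) \<sigma>" using assms(1) by (simp add: entails_def)
  then show ?thesis using N(2)[OF assms(3)] by blast
qed

lemma is_model_imp_satisfiable:
  fixes M :: "('f, 'p, 'm) interp"
  assumes "T \<subseteq> sentences L" "is_model L T M"
  shows "satisfiable L T"
proof -
  obtain N :: "('f, 'p, ('f, 'p) fm) interp" where N: "is_structure L N"
    "\<And>\<sigma> s s'. \<sigma> \<in> sentences L \<Longrightarrow> sat N s \<sigma> \<longleftrightarrow> sat M s' \<sigma>"
    using downward_Loewenheim_Skolem assms(2) unfolding is_model_def by blast
  have "is_model L T N" using N(1) N(2) assms unfolding is_model_def by (meson subsetD)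
  then show ?thesis by (auto simp: satisfiable_def)
qed

section \<open>Formulas with parameters\<close>

fun assign :: "(nat \<Rightarrow> 'm) \<Rightarrow> nat list \<Rightarrow> 'm list \<Rightarrow> nat \<Rightarrow> 'm" where
  "assign s (v # vs) (a # as) = (assign s vs as)(v := a)"
| "assign s _ _ = s"

text \<open>A formula with parameters, in the object variables \<open>x\<close>, is a pair of a formula and an
  assignment giving the parameters plugged in for its free variables outside \<open>x\<close>.\<close>

type_synonym ('f, 'p, 'm) pfm = "('f, 'p) fm \<times> (nat \<Rightarrow> 'm)"

definition pfm_over ::
  "('f, 'p) language \<Rightarrow> 'm set \<Rightarrow> nat list \<Rightarrow> ('f, 'p, 'm) pfm \<Rightarrow> bool" where
  "pfm_over L A x = (\<lambda>(\<phi>, s). formula_of L \<phi> \<and> s ` (fv \<phi> - set x) \<subseteq> A)"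

definition realises ::
  "('f, 'p, 'm) interp \<Rightarrow> nat list \<Rightarrow> 'm list \<Rightarrow> ('f, 'p, 'm) pfm set \<Rightarrow> bool" where
  "realises M x b \<Gamma> \<longleftrightarrow> length b = length x \<and> set b \<subseteq> univ M \<and>
     (\<forall>(\<phi>, s)\<in>\<Gamma>. sat M (assign s x b) \<phi>)"

text \<open>Consistency of a set of formulas over \<open>M\<close> is consistency with the elementary diagram
  of \<open>M\<close>, that is, finite satisfiability in \<open>M\<close>.\<close>

definition consistent_in ::
  "('f, 'p, 'm) interp \<Rightarrow> nat list \<Rightarrow> ('f, 'p, 'm) pfm set \<Rightarrow> bool" where
  "consistent_in M x \<Gamma> \<longleftrightarrow> (\<forall>\<Delta>. finite \<Delta> \<and> \<Delta> \<subseteq> \<Gamma> \<longrightarrow> (\<exists>b. realises M x b \<Delta>))"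

section \<open>Monster models\<close>

definition saturated ::
  "('f, 'p) language \<Rightarrow> 'k rel \<Rightarrow> ('f, 'p, 'm) interp \<Rightarrow> bool" where
  "saturated L \<kappa> M \<longleftrightarrow>
     (\<forall>A v \<Gamma>. A \<subseteq> univ M \<and> |A| <o \<kappa> \<and> (\<forall>\<gamma>\<in>\<Gamma>. pfm_over L A [v] \<gamma>) \<and> consistent_in M [v] \<Gamma>
       \<longrightarrow> (\<exists>b. realises M [v] b \<Gamma>))"

definition elementary_map ::
  "('f, 'p) language \<Rightarrow> ('f, 'p, 'm) interp \<Rightarrow> 'm set \<Rightarrow> ('m \<Rightarrow> 'm) \<Rightarrow> bool" where
  "elementary_map L M A h \<longleftrightarrow> A \<subseteq> univ M \<and> h ` A \<subseteq> univ M \<and>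
     (\<forall>\<phi> s. formula_of L \<phi> \<and> s ` fv \<phi> \<subseteq> A \<longrightarrow> (sat M s \<phi> \<longleftrightarrow> sat M (h \<circ> s) \<phi>))"

definition automorphism ::
  "('f, 'p) language \<Rightarrow> ('f, 'p, 'm) interp \<Rightarrow> ('m \<Rightarrow> 'm) \<Rightarrow> bool" where
  "automorphism L M h \<longleftrightarrow> bij_betw h (univ M) (univ M) \<and>
     (\<forall>f\<in>funs L. \<forall>as. length as = far L f \<and> set as \<subseteq> univ M
        \<longrightarrow> h (fint M f as) = fint M f (map h as)) \<and>
     (\<forall>p\<in>rels L. \<forall>as. length as = rar L p \<and> set as \<subseteq> univ M
        \<longrightarrow> (rint M p as \<longleftrightarrow> rint M p (map h as)))"

definition strongly_homogeneous ::
  "('f, 'p) language \<Rightarrow> 'k rel \<Rightarrow> ('f, 'p, 'm) interp \<Rightarrow> bool" where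
  "strongly_homogeneous L \<kappa> M \<longleftrightarrow>
     (\<forall>A h. |A| <o \<kappa> \<and> elementary_map L M A h
       \<longrightarrow> (\<exists>h'. automorphism L M h' \<and> (\<forall>a\<in>A. h' a = h a)))"

text \<open>Of the usual \<open>sufficiently large\<close> cardinal \<open>\<kappa>\<close> we only ask that it exceeds
  \<open>|L| + \<aleph>\<^sub>0\<close>.\<close>

definition monster_model ::
  "('f, 'p) language \<Rightarrow> ('f, 'p) fm set \<Rightarrow> 'k rel \<Rightarrow> ('f, 'p, 'm) interp \<Rightarrow> bool" where
  "monster_model L T \<kappa> M \<longleftrightarrow> is_model L T M \<and>
     Card_order \<kappa> \<and> natLeq <o \<kappa> \<and> |funs L <+> rels L| <o \<kappa> \<and>
     saturated L \<kappa> M \<and> strongly_homogeneous L \<kappa> M"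

section \<open>The antichain tree property\<close>

definition antichain :: "bool list set \<Rightarrow> bool" where
  "antichain X \<longleftrightarrow> (\<forall>\<eta>\<in>X. \<forall>\<nu>\<in>X. \<eta> \<noteq> \<nu> \<longrightarrow> \<eta> \<parallel> \<nu>)"

text \<open>The formula \<open>\<theta>(x, a)\<close> obtained by plugging \<open>a\<close> in for the parameter variables \<open>w\<close>.\<close>

definition inst :: "('f, 'p) fm \<Rightarrow> nat list \<Rightarrow> 'm list \<Rightarrow> ('f, 'p, 'm) pfm" where
  "inst \<theta> w a = (\<theta>, assign (\<lambda>_. undefined) w a)"

definition partitioned_formula ::
  "('f, 'p) language \<Rightarrow> ('f, 'p) fm \<Rightarrow> nat list \<Rightarrow> nat list \<Rightarrow> bool" where
  "partitioned_formula L \<theta> x w \<longleftrightarrow>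
     formula_of L \<theta> \<and> distinct (x @ w) \<and> fv \<theta> \<subseteq> set x \<union> set w"

definition witnesses_ATP ::
  "('f, 'p, 'm) interp \<Rightarrow> ('f, 'p) fm \<Rightarrow> nat list \<Rightarrow> nat list \<Rightarrow> bool" where
  "witnesses_ATP M \<theta> x w \<longleftrightarrow>
     (\<exists>a :: bool list \<Rightarrow> 'm list.
        (\<forall>\<eta>. length (a \<eta>) = length w \<and> set (a \<eta>) \<subseteq> univ M) \<and>
        (\<forall>X. antichain X \<longrightarrow> consistent_in M x {inst \<theta> w (a \<eta>) |\<eta>. \<eta> \<in> X}) \<and>
        (\<forall>\<eta> \<nu>. prefix \<eta> \<nu> \<and> \<eta> \<noteq> \<nu> \<longrightarrow>
           \<not> consistent_in M x {inst \<theta> w (a \<eta>), inst \<theta> w (a \<nu>)}))"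

end

theory Submission
  imports Defs
begin

text \<open>Fix parameters \<open>a \<eta>\<close> witnessing ATP for the disjunction.  Comparable nodes stay inconsistent for
  both disjuncts along any embedding of \<open>2\<^sup><\<^sup>\<omega>\<close> into itself, so it suffices to find an embedding whose
  antichains are all consistent for \<open>\<phi>\<close>, or one for \<open>\<psi>\<close>.  If there is none for \<open>\<phi>\<close>, one for
  \<open>\<psi>\<close> is built node by node: at each stage an antichain can be realised by \<open>\<psi>\<close> on the finitely many
  nodes already treated and by \<open>\<phi> \<or> \<psi>\<close> on the others.  To treat a node \<open>u\<close>, try all its extensions
  \<open>u @ s\<close>, assigning to different \<open>s\<close> incomparable parts of the untreated tree beside \<open>u\<close>.  If every \<open>s\<close>
  fails, the obstructing antichains for incomparable \<open>s\<close> can be united, and along a copy of the tree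
  on which they meet the treated nodes in the same set, the union forces \<open>\<phi>\<close> on all antichains.\<close>

section \<open>Embeddings of trees\<close>

lemma parallel_prefixes: "a \<parallel> b \<Longrightarrow> prefix a a' \<Longrightarrow> prefix b b' \<Longrightarrow> a' \<parallel> b'"
  by (auto simp: prefix_def intro: parallel_append)

text \<open>The first clause transports inconsistency of comparable nodes, the second transports
  antichains; so ATP parameters can be reindexed along such a map.\<close>

definition tree_embedding :: "('a list \<Rightarrow> 'b list) \<Rightarrow> bool" where
  "tree_embedding f \<longleftrightarrow>
     (\<forall>\<eta> \<nu>. strict_prefix \<eta> \<nu> \<longrightarrow> strict_prefix (f \<eta>) (f \<nu>)) \<and>
     (\<forall>\<eta> \<nu>. \<eta> \<parallel> \<nu> \<longrightarrow> f \<eta> \<parallel> f \<nu>)"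

lemma tree_embedding_comp:
  "tree_embedding f \<Longrightarrow> tree_embedding g \<Longrightarrow> tree_embedding (f \<circ> g)"
  by (simp add: tree_embedding_def)

lemma tree_embedding_append: "tree_embedding ((@) s)"
  by (auto simp: tree_embedding_def parallel_def strict_prefix_def)

lemma tree_embedding_antichain:
  assumes "tree_embedding f" "antichain X"
  shows "antichain (f ` X)"
  using assms by (force simp: antichain_def tree_embedding_def)

text \<open>Distinct children of \<open>t\<close> are sent into the cones above distinct children of
  \<open>f t\<close>, so images diverge where the nodes do. This suits maps built one letter at a
  time.\<close>

lemma tree_embedding_snocI:
  fixes f :: "'a list \<Rightarrow> 'a list"
  assumes "\<And>t b. prefix (f t @ [b]) (f (t @ [b]))"
  shows "tree_embedding f"
proof -
  have ext: "prefix (f t) (f (t @ s))" for t s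
  proof (induction s rule: rev_induct)
    case (snoc b s)
    have "prefix (f (t @ s)) (f (t @ s @ [b]))"
      using assms[of "t @ s" b] by (auto simp: prefix_def)
    with snoc show ?case by (rule prefix_order.trans)
  qed simp
  have step: "prefix (f t @ [b]) (f (t @ b # s))" for t b s
    using prefix_order.trans[OF assms ext[of "t @ [b]" s]] by simp
  show ?thesis
    unfolding tree_embedding_def
  proof (intro conjI allI impI)
    fix \<eta> \<nu> :: "'a list" assume "strict_prefix \<eta> \<nu>"
    then obtain b s where "\<nu> = \<eta> @ b # s" by (auto elim: strict_prefixE')
    with step[of \<eta> b s] show "strict_prefix (f \<eta>) (f \<nu>)"
      by (auto simp: strict_prefix_def prefix_def)
  next
    fix \<eta> \<nu> :: "'a list" assume "\<eta> \<parallel> \<nu>"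
    from parallel_decomp[OF this] obtain t b c s s'
      where bc: "b \<noteq> c" and eq: "\<eta> = t @ b # s" "\<nu> = t @ c # s'" by blast
    have "f t @ [b] \<parallel> f t @ [c]" using bc by (simp add: parallel_def)
    then show "f \<eta> \<parallel> f \<nu>"
      unfolding eq by (rule parallel_prefixes[OF _ step step])
  qed
qed

text \<open>Either some colour is dense above every node, and a copy of that colour is built greedily, or
  some cone misses a colour.\<close>

lemma monochromatic_embedding:
  fixes c :: "'a list \<Rightarrow> 'c"
  assumes "finite C" "range c \<subseteq> C"
  shows "\<exists>(f :: 'a list \<Rightarrow> 'a list) k. tree_embedding f \<and> (\<forall>t. c (f t) = k)"
  using assms
proof (induction C arbitrary: c rule: finite_induct)
  case (insert k C)
  show ?case
  proof (cases "\<forall>s. \<exists>t. prefix s t \<and> c t = k")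
    case True
    then obtain e where e: "\<And>s. prefix s (e s)" "\<And>s. c (e s) = k" by metis
    \<comment> \<open>Nodes grow at their end while \<open>rec_list\<close> peels off the head, so
      \<open>g\<close> reads the reversed node: from the previous value it goes to the child
      \<open>b\<close>, then up to colour \<open>k\<close>.\<close>
    define g where "g = rec_list (e []) (\<lambda>b _ r. e (r @ [b]))"
    have g: "g [] = e []" "g (b # r) = e (g r @ [b])" for b r by (simp_all add: g_def)
    have "tree_embedding (g \<circ> rev)"
      by (rule tree_embedding_snocI) (simp add: g e)
    moreover have "c ((g \<circ> rev) t) = k" for t
      by (cases "rev t") (simp_all add: g e)
    ultimately show ?thesis by blast
  next
    case False
    then obtain s where "\<And>t. c (s @ t) \<noteq> k" by (metis prefixI)
    then have "range (c \<circ> (@) s) \<subseteq> C" using insert.prems by auto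
    from insert.IH[OF this] obtain f :: "'a list \<Rightarrow> 'a list" and k'
      where f: "tree_embedding f" "\<And>t. c (s @ f t) = k'"
      by auto
    have "tree_embedding ((@) s \<circ> f)"
      by (rule tree_embedding_comp[OF tree_embedding_append f(1)])
    with f(2) show ?thesis by (metis comp_apply)
  qed
qed simp

text \<open>A prefix-free code: \<open>True\<close> announces another bit, \<open>False\<close> ends
  the word. Even comparable strings get incomparable codes.\<close>

fun prefix_code :: "bool list \<Rightarrow> bool list" where
  "prefix_code [] = [False]"
| "prefix_code (b # s) = True # b # prefix_code s"

lemma prefix_code_parallel: "s \<noteq> t \<Longrightarrow> prefix_code s \<parallel> prefix_code t"
proof (induction s arbitrary: t)
  case Nil
  then show ?case by (cases t) (auto simp: parallel_def)
next
  case (Cons b s)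
  then show ?case by (cases t) (auto simp: parallel_def)
qed

section \<open>Grafting above a finite subtree\<close>

definition prefix_closed :: "'a list set \<Rightarrow> bool" where
  "prefix_closed P \<longleftrightarrow> (\<forall>\<eta>\<in>P. \<forall>\<zeta>. prefix \<zeta> \<eta> \<longrightarrow> \<zeta> \<in> P)"

definition frontier :: "'a list set \<Rightarrow> 'a list set" where
  "frontier P = {w. w \<notin> P \<and> (\<forall>\<zeta>. strict_prefix \<zeta> w \<longrightarrow> \<zeta> \<in> P)}"

text \<open>For \<eta> outside \<open>P\<close> this is the unique frontier node that is a prefix of
  \<eta>. For \<eta> in \<open>P\<close>, \<open>graft\<close> does not consult it.\<close>

definition exit_node :: "'a list set \<Rightarrow> 'a list \<Rightarrow> 'a list" where
  "exit_node P \<eta> = take (LEAST k. take k \<eta> \<notin> P) \<eta>"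

text \<open>For prefix-closed \<open>P\<close>, the cone above each frontier node \<open>w\<close>
  is moved rigidly onto the cone above \<open>w @ r w\<close>, with a word \<open>r w\<close> chosen
  separately for each \<open>w\<close>.\<close>

definition graft :: "'a list set \<Rightarrow> ('a list \<Rightarrow> 'a list) \<Rightarrow> 'a list \<Rightarrow> 'a list" where
  "graft P r \<eta> = (if \<eta> \<in> P then \<eta>
     else exit_node P \<eta> @ r (exit_node P \<eta>) @ drop (length (exit_node P \<eta>)) \<eta>)"

lemma exit_node_prefix: "prefix (exit_node P \<eta>) \<eta>"
  by (simp add: exit_node_def take_is_prefix)

lemma exit_node_frontier:
  assumes "\<eta> \<notin> P"
  shows "exit_node P \<eta> \<in> frontier P"
proof -
  let ?k = "LEAST k. take k \<eta> \<notin> P"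
  have "take (length \<eta>) \<eta> \<notin> P" using assms by simp
  then have "take ?k \<eta> \<notin> P" by (rule LeastI)
  moreover have "\<zeta> \<in> P" if "strict_prefix \<zeta> (take ?k \<eta>)" for \<zeta>
  proof -
    have "length \<zeta> < ?k" using prefix_length_less[OF that] by simp
    moreover have "take (length \<zeta>) \<eta> = \<zeta>"
      using that by (metis prefix_order.less_imp_le prefix_order.trans take_is_prefix append_eq_conv_conj prefixE)
    ultimately show ?thesis using not_less_Least by metis
  qed
  ultimately show ?thesis unfolding frontier_def exit_node_def by blast
qed

lemma frontier_parallel: "w \<in> frontier P \<Longrightarrow> w' \<in> frontier P \<Longrightarrow> w \<noteq> w' \<Longrightarrow> w \<parallel> w'"
  by (auto simp: frontier_def parallel_def strict_prefix_def)

text \<open>Two prefixes of one node are comparable, while distinct frontier nodes are not.\<close>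

lemma exit_node_eqI:
  assumes "w \<in> frontier P" "prefix w \<eta>" "\<eta> \<notin> P"
  shows "exit_node P \<eta> = w"
  using exit_node_frontier[OF assms(3)] exit_node_prefix[of P \<eta>] assms(1,2)
    frontier_parallel[of w P "exit_node P \<eta>"]
  by (metis parallel_def prefix_same_cases)

lemma graft_in: "\<eta> \<in> P \<Longrightarrow> graft P r \<eta> = \<eta>"
  by (simp add: graft_def)

lemma graft_out_prefix: "\<eta> \<notin> P \<Longrightarrow> prefix (exit_node P \<eta>) (graft P r \<eta>)"
  by (simp add: graft_def)

lemma graft_frontier: "u \<in> frontier P \<Longrightarrow> graft P r u = u @ r u"
  using exit_node_eqI[of u P u] by (simp add: graft_def frontier_def)

lemma graft_parallel_exit:
  assumes "\<eta> \<notin> P" "\<nu> \<notin> P" "exit_node P \<eta> \<noteq> exit_node P \<nu>"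
  shows "graft P r \<eta> \<parallel> graft P r' \<nu>"
  using frontier_parallel[OF exit_node_frontier exit_node_frontier] assms graft_out_prefix
  by (meson parallel_prefixes)

text \<open>This compares two different grafts over the same \<open>P\<close>. If the exit nodes
  agree, the inserted words separate the images; otherwise the frontier does, whatever the words
  are.\<close>

lemma graft_parallel_code:
  assumes "\<eta> \<notin> P" "\<nu> \<notin> P" "r (exit_node P \<eta>) \<parallel> r' (exit_node P \<eta>)"
  shows "graft P r \<eta> \<parallel> graft P r' \<nu>"
proof (cases "exit_node P \<eta> = exit_node P \<nu>")
  case True
  then show ?thesis using assms parallel_append[OF assms(3)]
    by (simp add: graft_def parallel_def)
next
  case False
  with assms(1,2) show ?thesis by (rule graft_parallel_exit)
qed

text \<open>Were the exit node of \<nu> a prefix of \<eta>, it would lie in the prefix-closed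
  \<open>P\<close>. Both claims follow, since it is a prefix of \<nu>.\<close>

lemma in_out_exit:
  assumes "prefix_closed P" "\<eta> \<in> P" "\<nu> \<notin> P"
  shows "prefix \<eta> \<nu> \<Longrightarrow> strict_prefix \<eta> (exit_node P \<nu>)"
    and "\<eta> \<parallel> \<nu> \<Longrightarrow> \<eta> \<parallel> exit_node P \<nu>"
proof -
  have "\<not> prefix (exit_node P \<nu>) \<eta>"
    using exit_node_frontier[OF assms(3)] assms(1,2) unfolding prefix_closed_def frontier_def by blast
  then show "prefix \<eta> \<nu> \<Longrightarrow> strict_prefix \<eta> (exit_node P \<nu>)"
    and "\<eta> \<parallel> \<nu> \<Longrightarrow> \<eta> \<parallel> exit_node P \<nu>"
    using exit_node_prefix[of P \<nu>] unfolding parallel_def strict_prefix_def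
    by (metis prefix_same_cases prefix_order.order_refl, metis prefix_order.trans)
qed

text \<open>Nodes with the same exit node keep their relative position, those with different exit
  nodes are separated by the frontier, and a node of \<open>P\<close> relates to an outer node as it
  does to the exit node of the latter.\<close>

lemma graft_embedding:
  assumes P: "prefix_closed P"
  shows "tree_embedding (graft P r)"
  unfolding tree_embedding_def
proof (intro conjI allI impI)
  fix \<eta> \<nu> :: "'a list" assume sp: "strict_prefix \<eta> \<nu>"
  show "strict_prefix (graft P r \<eta>) (graft P r \<nu>)"
  proof (cases "\<nu> \<in> P")
    case True
    then have "\<eta> \<in> P" using sp P by (auto simp: prefix_closed_def strict_prefix_def)
    then show ?thesis using sp True by (simp add: graft_in)
  next
    case \<nu>: False
    show ?thesis
    proof (cases "\<eta> \<in> P")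
      case True
      then show ?thesis
        using in_out_exit(1)[OF P True \<nu>] sp graft_out_prefix[OF \<nu>, of r]
        by (simp add: graft_in) (meson prefix_order.less_imp_le prefix_order.less_le_trans)
    next
      case \<eta>: False
      have pre: "prefix (exit_node P \<eta>) \<nu>"
        using exit_node_prefix[of P \<eta>] sp by (meson prefix_order.less_imp_le prefix_order.trans)
      have eq: "exit_node P \<nu> = exit_node P \<eta>"
        by (rule exit_node_eqI[OF exit_node_frontier[OF \<eta>] pre \<nu>])
      obtain t where t: "\<eta> = exit_node P \<eta> @ t" using exit_node_prefix[of P \<eta>] by (auto simp: prefix_def)
      obtain t' where t': "\<nu> = \<eta> @ t'" "t' \<noteq> []" using sp by (auto simp: strict_prefix_def prefix_def)
      have "drop (length (exit_node P \<eta>)) \<nu> = drop (length (exit_node P \<eta>)) \<eta> @ t'"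
        using t' t by (metis append.assoc append_eq_conv_conj)
      then have "graft P r \<nu> = graft P r \<eta> @ t'" using \<eta> \<nu> by (simp add: graft_def eq)
      then show ?thesis using t'(2) by (simp add: strict_prefix_def)
    qed
  qed
next
  fix \<eta> \<nu> :: "'a list" assume par: "\<eta> \<parallel> \<nu>"
  have mixed: "graft P r \<eta> \<parallel> graft P r \<nu>" if "\<eta> \<in> P" "\<nu> \<notin> P" "\<eta> \<parallel> \<nu>" for \<eta> \<nu>
    using in_out_exit(2)[OF P that] graft_out_prefix[OF that(2)] that(1)
    by (metis graft_in parallel_prefixes prefix_order.order_refl)
  consider "\<eta> \<in> P" "\<nu> \<in> P" | "\<eta> \<in> P" "\<nu> \<notin> P" | "\<eta> \<notin> P" "\<nu> \<in> P"
    | "\<eta> \<notin> P" "\<nu> \<notin> P" "exit_node P \<eta> \<noteq> exit_node P \<nu>"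
    | "\<eta> \<notin> P" "\<nu> \<notin> P" "exit_node P \<eta> = exit_node P \<nu>" by blast
  then show "graft P r \<eta> \<parallel> graft P r \<nu>"
  proof cases
    case 1
    then show ?thesis using par by (simp add: graft_in)
  next
    case 2
    then show ?thesis using par by (rule mixed)
  next
    case 3
    then show ?thesis using par mixed by (metis parallel_commute)
  next
    case 4
    then show ?thesis by (rule graft_parallel_exit)
  next
    case 5
    obtain t where t: "\<eta> = exit_node P \<eta> @ t" using exit_node_prefix[of P \<eta>] by (auto simp: prefix_def)
    obtain t' where t': "\<nu> = exit_node P \<eta> @ t'"
      using exit_node_prefix[of P \<nu>] 5(3) by (auto simp: prefix_def)
    have "t \<parallel> t'" using par t t' by (metis parallel_def same_prefix_prefix)
    moreover have "drop (length (exit_node P \<eta>)) \<eta> = t" "drop (length (exit_node P \<eta>)) \<nu> = t'"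
      using t t' by (metis append_eq_conv_conj)+
    ultimately show ?thesis using 5 by (simp add: graft_def parallel_def)
  qed
qed

section \<open>The dichotomy for antichains\<close>

text \<open>\<open>W\<close> stands for the tuples that may realise formulas,
  \<open>A b \<eta>\<close> for \<open>b\<close> satisfying the formula at \<eta>. Finite antichains
  are the right test because consistency is finite satisfiability.\<close>

definition full :: "'w set \<Rightarrow> ('w \<Rightarrow> bool list \<Rightarrow> bool) \<Rightarrow> bool" where
  "full W A \<longleftrightarrow> (\<forall>X. finite X \<and> antichain X \<longrightarrow> (\<exists>b\<in>W. \<forall>\<eta>\<in>X. A b \<eta>))"

text \<open>\<open>P\<close> is the set of treated nodes.\<close>

definition stage ::
  "'w set \<Rightarrow> ('w \<Rightarrow> bool list \<Rightarrow> bool) \<Rightarrow> ('w \<Rightarrow> bool list \<Rightarrow> bool) \<Rightarrow> bool list set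
    \<Rightarrow> (bool list \<Rightarrow> bool list) \<Rightarrow> bool" where
  "stage W A B P f \<longleftrightarrow> tree_embedding f \<and>
     full W (\<lambda>b \<eta>. B b (f \<eta>) \<or> \<eta> \<notin> P \<and> A b (f \<eta>))"

text \<open>The new embedding is sought among the maps \<open>f \<circ> \<sigma> s\<close>, all of
  which agree with \<open>f\<close> on \<open>P\<close>; failure of every \<open>s\<close>
  contradicts \<open>no\<close>.\<close>

lemma stage_step:
  assumes P: "finite P" "prefix_closed P" and u: "u \<in> frontier P" and f: "stage W A B P f"
    and no: "\<nexists>g. tree_embedding g \<and> full W (\<lambda>b \<eta>. A b (g \<eta>))"
  shows "\<exists>f'. stage W A B (insert u P) f' \<and> (\<forall>\<eta>\<in>P. f' \<eta> = f \<eta>)"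
proof -
  \<comment> \<open>At \<open>u\<close> the word \<open>s\<close> itself is inserted, so the images
    of \<open>u\<close> run through all its extensions; at the other frontier nodes the codes keep
    distinct \<open>s\<close> apart.\<close>
  define r where "r s = (\<lambda>w. if w = u then s else prefix_code s)" for s
  define \<sigma> where "\<sigma> s = graft P (r s)" for s
  have \<sigma>_emb: "tree_embedding (\<sigma> s)" for s
    unfolding \<sigma>_def by (rule graft_embedding[OF P(2)])
  have \<sigma>_in: "\<sigma> s \<eta> = \<eta>" if "\<eta> \<in> P" for s \<eta> using that by (simp add: \<sigma>_def graft_in)
  have \<sigma>_u: "\<sigma> s u = u @ s" for s by (simp add: \<sigma>_def graft_frontier[OF u] r_def)
  have f_emb: "tree_embedding f" using f by (simp add: stage_def)
  have f_full: "\<exists>b\<in>W. \<forall>\<eta>\<in>X. B b (f \<eta>) \<or> \<eta> \<notin> P \<and> A b (f \<eta>)" if "finite X" "antichain X" for X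
    using f that by (simp add: stage_def full_def)
  have u_out: "u \<notin> P" using u by (simp add: frontier_def)
  show ?thesis
  proof (cases "\<exists>s. stage W A B (insert u P) (f \<circ> \<sigma> s)")
    case True
    then show ?thesis using \<sigma>_in by (metis comp_apply)
  next
    case False
    have "\<exists>X. finite X \<and> antichain X \<and>
      (\<forall>b\<in>W. \<exists>\<eta>\<in>X. \<not> (B b (f (\<sigma> s \<eta>)) \<or> \<eta> \<notin> insert u P \<and> A b (f (\<sigma> s \<eta>))))" for s
      using False tree_embedding_comp[OF f_emb \<sigma>_emb] unfolding stage_def full_def by (metis comp_apply)
    then obtain X where X: "\<And>s. finite (X s)" "\<And>s. antichain (X s)"
      and bad: "\<And>s b. b \<in> W \<Longrightarrow>
        \<exists>\<eta>\<in>X s. \<not> (B b (f (\<sigma> s \<eta>)) \<or> \<eta> \<notin> insert u P \<and> A b (f (\<sigma> s \<eta>)))"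
      by metis
    \<comment> \<open>Away from \<open>u\<close> the old and the new stage demand the same, so an
      obstruction avoiding \<open>u\<close> would have its image under \<open>\<sigma> s\<close>
      realised by the old stage.\<close>
    have uX: "u \<in> X s" for s
    proof (rule ccontr)
      assume "u \<notin> X s"
      obtain b where "b \<in> W" "\<forall>\<eta>\<in>\<sigma> s ` X s. B b (f \<eta>) \<or> \<eta> \<notin> P \<and> A b (f \<eta>)"
        using f_full[of "\<sigma> s ` X s"] X tree_embedding_antichain[OF \<sigma>_emb] by blast
      with bad[of b s] \<open>u \<notin> X s\<close> \<sigma>_in show False by (metis imageI insertE)
    qed
    have par_u: "\<eta> \<parallel> u" if "\<eta> \<in> X s" "\<eta> \<noteq> u" for \<eta> s
      using X(2)[of s] uX[of s] that by (simp add: antichain_def)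
    \<comment> \<open>Each \<open>s\<close> is coloured by the trace of \<open>X s\<close> on the
      finite set \<open>P\<close>; \<open>h\<close> picks a copy of the tree with constant trace
      \<open>J\<close>. Every \<open>\<sigma> s\<close> fixes \<open>J\<close>, so these
      obstructions share it.\<close>
    have "range (\<lambda>s. X s \<inter> P) \<subseteq> Pow P" by blast
    from monochromatic_embedding[OF _ this] P(1) obtain h :: "bool list \<Rightarrow> bool list" and J
      where h: "tree_embedding h" and J: "\<And>t. X (h t) \<inter> P = J" by auto
    \<comment> \<open>\<open>?g t\<close> is \<open>f (\<sigma> (h t) u)\<close>, the image of
      \<open>u\<close> under the failed attempt for \<open>h t\<close>.\<close>
    let ?g = "f \<circ> (@) u \<circ> h"
    have "full W (\<lambda>b \<eta>. A b (?g \<eta>))"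
      unfolding full_def
    proof (intro allI impI, elim conjE)
      fix I :: "bool list set" assume I: "finite I" "antichain I"
      define Y where "Y t = \<sigma> (h t) ` X (h t)" for t
      have Y_cases: "\<exists>x\<in>X (h t). \<eta> = \<sigma> (h t) x \<and> (\<eta> \<in> J \<or> x = u \<or> x \<notin> P \<and> x \<noteq> u)"
        if "\<eta> \<in> Y t" for \<eta> t
        using that J[of t] \<sigma>_in unfolding Y_def by (cases "\<eta> \<in> P") fastforce+
      have JY: "J \<subseteq> Y t" for t
        using J[of t] \<sigma>_in unfolding Y_def by (metis IntE image_iff subsetI)
      have antiY: "antichain (Y t)" for t
        unfolding Y_def by (rule tree_embedding_antichain[OF \<sigma>_emb X(2)])
      \<comment> \<open>Nodes outside \<open>J\<close> come from outside \<open>P\<close>. There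
        \<open>h t\<close> and \<open>h t'\<close>, being incomparable, insert incomparable words at
        every exit node, \<open>u\<close> included.\<close>
      have cross: "\<eta> \<parallel> \<nu>" if t: "t \<in> I" "t' \<in> I" "t \<noteq> t'"
        and \<eta>: "\<eta> \<in> Y t" "\<eta> \<notin> J" and \<nu>: "\<nu> \<in> Y t'" "\<nu> \<notin> J" for \<eta> \<nu> t t'
      proof -
        obtain x where x: "x \<in> X (h t)" "\<eta> = \<sigma> (h t) x" "x \<notin> P"
          using Y_cases[OF \<eta>(1)] \<eta>(2) u_out by blast
        obtain x' where x': "x' \<in> X (h t')" "\<nu> = \<sigma> (h t') x'" "x' \<notin> P"
          using Y_cases[OF \<nu>(1)] \<nu>(2) u_out by blast
        have "t \<parallel> t'" using I(2) t by (simp add: antichain_def)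
        then have ht: "h t \<parallel> h t'" using h by (simp add: tree_embedding_def)
        then have "h t \<noteq> h t'" by (auto simp: parallel_def)
        then have "r (h t) (exit_node P x) \<parallel> r (h t') (exit_node P x)"
          using ht prefix_code_parallel by (simp add: r_def)
        then show ?thesis unfolding x(2) x'(2) \<sigma>_def
          by (rule graft_parallel_code[OF x(3) x'(3)])
      qed
      let ?X = "J \<union> (\<Union>t\<in>I. Y t)"
      have "antichain ?X"
        unfolding antichain_def
      proof (intro ballI impI)
        fix \<eta> \<nu> assume "\<eta> \<in> ?X" "\<nu> \<in> ?X" and ne: "\<eta> \<noteq> \<nu>"
        then consider t where "\<eta> \<in> Y t" "\<nu> \<in> Y t"
          | t t' where "t \<in> I" "t' \<in> I" "t \<noteq> t'" "\<eta> \<in> Y t" "\<eta> \<notin> J" "\<nu> \<in> Y t'" "\<nu> \<notin> J"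
          using JY by blast
        then show "\<eta> \<parallel> \<nu>"
        proof cases
          case 1
          then show ?thesis using antiY ne by (auto simp: antichain_def)
        next
          case 2
          then show ?thesis by (rule cross)
        qed
      qed
      moreover have "finite ?X"
        using I(1) X(1) P(1) J[of "[]"] by (auto simp: Y_def)
      ultimately obtain b where b: "b \<in> W" "\<forall>\<eta>\<in>?X. B b (f \<eta>) \<or> \<eta> \<notin> P \<and> A b (f \<eta>)"
        using f_full by meson
      \<comment> \<open>On \<open>X (h t)\<close>, \<open>b\<close> meets the old demands but not
        the new ones. They differ only at \<open>u\<close>, so there \<open>B\<close> fails and
        \<open>A\<close> holds.\<close>
      have "A b (?g t)" if t: "t \<in> I" for t
      proof -
        have all: "B b (f (\<sigma> (h t) x)) \<or> x \<notin> P \<and> A b (f (\<sigma> (h t) x))" if "x \<in> X (h t)" for x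
        proof -
          have "\<sigma> (h t) x \<in> ?X" using t that by (auto simp: Y_def)
          then show ?thesis using b(2) \<sigma>_in[of x "h t"] by (cases "x \<in> P") auto
        qed
        obtain x where "x \<in> X (h t)"
          "\<not> (B b (f (\<sigma> (h t) x)) \<or> x \<notin> insert u P \<and> A b (f (\<sigma> (h t) x)))"
          using bad[OF b(1)] by blast
        with all have "x = u" "A b (f (\<sigma> (h t) x))" by auto
        then show ?thesis by (simp add: \<sigma>_u)
      qed
      then show "\<exists>b\<in>W. \<forall>t\<in>I. A b (?g t)" using b(1) by blast
    qed
    moreover have "tree_embedding ?g"
      by (intro tree_embedding_comp f_emb tree_embedding_append h)
    ultimately show ?thesis using no by blast
  qed
qed

text \<open>Nodes are treated one at a time: the exit node of any \<eta> in \<open>Q - P\<close>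
  lies in \<open>Q\<close>, and adding a frontier node keeps \<open>P\<close> prefix-closed.\<close>

lemma stage_extend:
  assumes "finite Q" "prefix_closed Q" "prefix_closed P" "P \<subseteq> Q" "stage W A B P f"
    and no: "\<nexists>g. tree_embedding g \<and> full W (\<lambda>b \<eta>. A b (g \<eta>))"
  shows "\<exists>f'. stage W A B Q f' \<and> (\<forall>\<eta>\<in>P. f' \<eta> = f \<eta>)"
  using assms(3-5)
proof (induction "card (Q - P)" arbitrary: P f rule: less_induct)
  case less
  show ?case
  proof (cases "P = Q")
    case True
    with less.prems show ?thesis by blast
  next
    case False
    then obtain \<eta> where "\<eta> \<in> Q" "\<eta> \<notin> P" using less.prems by blast
    define u where "u = exit_node P \<eta>"
    have u: "u \<in> frontier P" unfolding u_def using exit_node_frontier[OF \<open>\<eta> \<notin> P\<close>] .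
    have uQ: "u \<in> Q"
      using \<open>\<eta> \<in> Q\<close> exit_node_prefix[of P \<eta>] assms(2) by (auto simp: u_def prefix_closed_def)
    have fin: "finite P" using less.prems(2) assms(1) by (rule finite_subset)
    obtain f1 where f1: "stage W A B (insert u P) f1" "\<forall>\<eta>\<in>P. f1 \<eta> = f \<eta>"
      using stage_step[OF fin less.prems(1) u less.prems(3) no] by blast
    have card: "card (Q - insert u P) < card (Q - P)"
      using u uQ assms(1) by (intro psubset_card_mono) (auto simp: frontier_def)
    have closed: "prefix_closed (insert u P)"
      using u less.prems(1) unfolding prefix_closed_def frontier_def strict_prefix_def by blast
    have sub: "insert u P \<subseteq> Q" using uQ less.prems(2) by blast
    obtain f2 where "stage W A B Q f2" "\<forall>\<eta>\<in>insert u P. f2 \<eta> = f1 \<eta>"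
      using less.hyps[OF card closed sub f1(1)] by blast
    with f1(2) show ?thesis by auto
  qed
qed

text \<open>If no embedding is full for \<open>A\<close>, the levels are treated successively.
  Values on treated nodes never change again, so the embeddings converge; a finite antichain lies in
  some treated \<open>L n\<close>, where only \<open>B\<close> is left.\<close>

theorem antichain_dichotomy:
  assumes "full W (\<lambda>b \<eta>. A b \<eta> \<or> B b \<eta>)"
  shows "\<exists>f. tree_embedding f \<and> (full W (\<lambda>b \<eta>. A b (f \<eta>)) \<or> full W (\<lambda>b \<eta>. B b (f \<eta>)))"
proof (cases "\<exists>f. tree_embedding f \<and> full W (\<lambda>b \<eta>. A b (f \<eta>))")
  case no: False
  define L where "L n = {\<eta> :: bool list. length \<eta> < n}" for n
  have L: "finite (L n)" "prefix_closed (L n)" "L n \<subseteq> L (Suc n)" for n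
  proof -
    show "finite (L n)"
      using finite_lists_length_le[of "UNIV :: bool set" n]
      by (rule rev_finite_subset) (auto simp: L_def)
    show "prefix_closed (L n)"
      by (auto simp: prefix_closed_def L_def dest: prefix_length_le)
  qed (auto simp: L_def)
  have start: "stage W A B (L 0) id"
    using assms by (simp add: stage_def L_def tree_embedding_def disj_commute)
  obtain F where F: "\<And>n. stage W A B (L n) (F n)" "\<And>n. \<forall>\<eta>\<in>L n. F (Suc n) \<eta> = F n \<eta>"
    using dependent_nat_choice[of "\<lambda>n. stage W A B (L n)" "\<lambda>n f f'. \<forall>\<eta>\<in>L n. f' \<eta> = f \<eta>"]
      start stage_extend[OF L(1,2,2,3) _ no] by blast
  have stable: "F (m + n) \<eta> = F m \<eta>" if "\<eta> \<in> L m" for m n \<eta>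
    using that
  proof (induction n)
    case (Suc n)
    then have "\<eta> \<in> L (m + n)" by (simp add: L_def)
    with F(2) Suc show ?case by simp
  qed simp
  \<comment> \<open>\<open>L n\<close> holds the lengths strictly below \<open>n\<close>, so \<eta>
    is treated from stage \<open>Suc (length \<eta>)\<close> on.\<close>
  define f where "f \<eta> = F (Suc (length \<eta>)) \<eta>" for \<eta>
  have f: "f \<eta> = F n \<eta>" if "length \<eta> < n" for n \<eta>
    using stable[of \<eta> "Suc (length \<eta>)" "n - Suc (length \<eta>)"] that by (simp add: f_def L_def)
  have "tree_embedding f"
    unfolding tree_embedding_def
  proof (intro conjI allI impI)
    fix \<eta> \<nu> :: "bool list"
    let ?n = "Suc (length \<eta> + length \<nu>)"
    have eq: "f \<eta> = F ?n \<eta>" "f \<nu> = F ?n \<nu>" by (simp_all add: f)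
    have emb: "tree_embedding (F ?n)" using F(1) by (simp add: stage_def)
    show "strict_prefix (f \<eta>) (f \<nu>)" if "strict_prefix \<eta> \<nu>"
      using emb that unfolding eq tree_embedding_def by blast
    show "f \<eta> \<parallel> f \<nu>" if "\<eta> \<parallel> \<nu>"
      using emb that unfolding eq tree_embedding_def by blast
  qed
  moreover have "full W (\<lambda>b \<eta>. B b (f \<eta>))"
    unfolding full_def
  proof (intro allI impI, elim conjE)
    fix X :: "bool list set" assume X: "finite X" "antichain X"
    obtain n where n: "\<forall>\<eta>\<in>X. length \<eta> < n"
      using X(1) finite_nat_set_iff_bounded[of "length ` X"] by auto
    obtain b where "b \<in> W" "\<forall>\<eta>\<in>X. B b (F n \<eta>) \<or> \<eta> \<notin> L n \<and> A b (F n \<eta>)"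
      using F(1)[of n] X unfolding stage_def full_def by meson
    moreover have "f \<eta> = F n \<eta>" if "\<eta> \<in> X" for \<eta> using n that by (simp add: f)
    ultimately show "\<exists>b\<in>W. \<forall>\<eta>\<in>X. B b (f \<eta>)" using n by (auto simp: L_def)
  qed
  ultimately show ?thesis by blast
qed blast

section \<open>Disjunctions witnessing ATP\<close>

lemma realises_mono: "realises M x b \<Gamma> \<Longrightarrow> \<Delta> \<subseteq> \<Gamma> \<Longrightarrow> realises M x b \<Delta>"
  by (auto simp: realises_def)

lemma consistent_in_finite:
  "finite \<Gamma> \<Longrightarrow> consistent_in M x \<Gamma> \<longleftrightarrow> (\<exists>b. realises M x b \<Gamma>)"
  unfolding consistent_in_def by (blast intro: realises_mono)

lemma consistent_in_image:
  "consistent_in M x {i \<eta> |\<eta>. \<eta> \<in> X} \<longleftrightarrow>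
     (\<forall>Y. finite Y \<and> Y \<subseteq> X \<longrightarrow> (\<exists>b. realises M x b (i ` Y)))"
  unfolding consistent_in_def Setcompr_eq_image by (simp only: all_finite_subset_image conj_commute)

lemma antichain_subset: "antichain X \<Longrightarrow> Y \<subseteq> X \<Longrightarrow> antichain Y"
  by (auto simp: antichain_def)

text \<open>Consistency is finite satisfiability and subsets of antichains are antichains, so
  \<open>full\<close> handles infinite antichains too. For a pair, consistency means one common
  realisation, which \<open>inc\<close> excludes.\<close>

lemma witnesses_ATPI:
  assumes a: "\<And>\<eta>. length (a \<eta>) = length w \<and> set (a \<eta>) \<subseteq> univ M"
    and full: "full {b. length b = length x \<and> set b \<subseteq> univ M}
      (\<lambda>b \<eta>. sat M (assign (assign (\<lambda>_. undefined) w (a \<eta>)) x b) \<theta>)"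
    and inc: "\<And>\<eta> \<nu> b. strict_prefix \<eta> \<nu> \<Longrightarrow> \<not> realises M x b {inst \<theta> w (a \<eta>), inst \<theta> w (a \<nu>)}"
  shows "witnesses_ATP M \<theta> x w"
  unfolding witnesses_ATP_def
proof (intro exI[of _ a] conjI allI impI)
  fix X assume X: "antichain X"
  show "consistent_in M x {inst \<theta> w (a \<eta>) |\<eta>. \<eta> \<in> X}"
    unfolding consistent_in_image
  proof (intro allI impI)
    fix Y assume Y: "finite Y \<and> Y \<subseteq> X"
    then have "antichain Y" using antichain_subset[OF X] by blast
    with Y full obtain b where "length b = length x" "set b \<subseteq> univ M"
      "\<forall>\<eta>\<in>Y. sat M (assign (assign (\<lambda>_. undefined) w (a \<eta>)) x b) \<theta>"
      unfolding full_def by blast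
    then have "realises M x b ((\<lambda>\<eta>. inst \<theta> w (a \<eta>)) ` Y)"
      by (auto simp: realises_def inst_def)
    then show "\<exists>b. realises M x b ((\<lambda>\<eta>. inst \<theta> w (a \<eta>)) ` Y)" ..
  qed
next
  fix \<eta> \<nu> :: "bool list" assume "prefix \<eta> \<nu> \<and> \<eta> \<noteq> \<nu>"
  then have "strict_prefix \<eta> \<nu>" by (simp add: strict_prefix_def)
  then show "\<not> consistent_in M x {inst \<theta> w (a \<eta>), inst \<theta> w (a \<nu>)}"
    using inc by (simp add: consistent_in_finite)
qed (simp_all only: a)

lemma assign_notin: "v \<notin> set vs \<Longrightarrow> assign s vs as v = s v"
  by (induction s vs as rule: assign.induct) auto

lemma assign_in_cong:
  "v \<in> set vs \<Longrightarrow> length as = length vs \<Longrightarrow> assign s vs as v = assign s' vs as v"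
  by (induction s vs as rule: assign.induct) auto

lemma assign_cong:
  "length as = length vs \<Longrightarrow> (v \<notin> set vs \<Longrightarrow> s v = s' v) \<Longrightarrow> assign s vs as v = assign s' vs as v"
  by (metis assign_in_cong assign_notin)

lemma assign_append:
  "length as = length vs \<Longrightarrow> assign s (vs @ ws) (as @ bs) = assign (assign s ws bs) vs as"
  by (induction s vs as rule: assign.induct) auto

theorem lemma3p18:
  fixes L :: "('f, 'p) language"
    and T :: "('f, 'p) fm set"
    and \<kappa> :: "'k rel"
    and M :: "('f, 'p, 'm) interp"
    and \<phi> \<psi> :: "('f, 'p) fm"
    and x y z :: "nat list"
  assumes "complete_theory L T"
    and "monster_model L T \<kappa> M"
    and "partitioned_formula L \<phi> x y"
    and "partitioned_formula L \<psi> x z"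
    and "distinct (x @ y @ z)"
    and "witnesses_ATP M (Disj \<phi> \<psi>) x (y @ z)"
  shows "witnesses_ATP M \<phi> x y \<or> witnesses_ATP M \<psi> x z"
proof -
  let ?W = "{b. length b = length x \<and> set b \<subseteq> univ M}"
  let ?u = "\<lambda>_ :: nat. undefined :: 'm"
  obtain a where a: "\<And>\<eta>. length (a \<eta>) = length (y @ z) \<and> set (a \<eta>) \<subseteq> univ M"
    and cons: "\<And>X. antichain X \<Longrightarrow> consistent_in M x {inst (Disj \<phi> \<psi>) (y @ z) (a \<eta>) |\<eta>. \<eta> \<in> X}"
    and inc: "\<And>\<eta> \<nu>. strict_prefix \<eta> \<nu> \<Longrightarrow>
      \<not> consistent_in M x {inst (Disj \<phi> \<psi>) (y @ z) (a \<eta>), inst (Disj \<phi> \<psi>) (y @ z) (a \<nu>)}"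
    using assms(6) unfolding witnesses_ATP_def strict_prefix_def by blast
  define p where "p \<eta> = take (length y) (a \<eta>)" for \<eta>
  define q where "q \<eta> = drop (length y) (a \<eta>)" for \<eta>
  have pq: "length (p \<eta>) = length y" "length (q \<eta>) = length z" "a \<eta> = p \<eta> @ q \<eta>" for \<eta>
    using a[of \<eta>] by (simp_all add: p_def q_def)
  have p: "length (p \<eta>) = length y \<and> set (p \<eta>) \<subseteq> univ M"
    and q: "length (q \<eta>) = length z \<and> set (q \<eta>) \<subseteq> univ M" for \<eta>
    using a[of \<eta>] pq[of \<eta>] by simp_all
  define A where "A b \<eta> = sat M (assign (assign ?u y (p \<eta>)) x b) \<phi>" for b \<eta>
  define B where "B b \<eta> = sat M (assign (assign ?u z (q \<eta>)) x b) \<psi>" for b \<eta>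
  \<comment> \<open>Free variables of \<phi> outside \<open>x\<close> lie in \<open>y\<close>, whose
    assignment is outermost and overrides that of \<open>z\<close>. Those of \<psi> lie in
    \<open>z\<close>, disjoint from \<open>y\<close>, so the assignment of \<open>y\<close> leaves
    them alone.\<close>
  have disj: "sat M (assign (assign ?u (y @ z) (a \<eta>)) x b) (Disj \<phi> \<psi>) \<longleftrightarrow> A b \<eta> \<or> B b \<eta>"
    if "b \<in> ?W" for b \<eta>
  proof -
    have as: "assign ?u (y @ z) (a \<eta>) = assign (assign ?u z (q \<eta>)) y (p \<eta>)"
      using pq assign_append by metis
    have "sat M (assign (assign ?u (y @ z) (a \<eta>)) x b) \<phi> \<longleftrightarrow> A b \<eta>"
      unfolding A_def as
    proof (rule sat_cong, rule assign_cong)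
      fix v assume v: "v \<in> fv \<phi>" "v \<notin> set x"
      then have "v \<in> set y" using assms(3) by (auto simp: partitioned_formula_def)
      then show "assign (assign ?u z (q \<eta>)) y (p \<eta>) v = assign ?u y (p \<eta>) v"
        by (rule assign_in_cong) (simp add: pq)
    qed (use that in simp)
    moreover have "sat M (assign (assign ?u (y @ z) (a \<eta>)) x b) \<psi> \<longleftrightarrow> B b \<eta>"
      unfolding B_def as
    proof (rule sat_cong, rule assign_cong)
      fix v assume v: "v \<in> fv \<psi>" "v \<notin> set x"
      then have "v \<in> set z" using assms(4) by (auto simp: partitioned_formula_def)
      then have "v \<notin> set y" using assms(5) by auto
      then show "assign (assign ?u z (q \<eta>)) y (p \<eta>) v = assign ?u z (q \<eta>) v"
        by (rule assign_notin)
    qed (use that in simp)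
    ultimately show ?thesis by simp
  qed
  have "full ?W (\<lambda>b \<eta>. A b \<eta> \<or> B b \<eta>)"
    unfolding full_def
  proof (intro allI impI, elim conjE)
    fix X :: "bool list set" assume X: "finite X" "antichain X"
    obtain b where b: "realises M x b ((\<lambda>\<eta>. inst (Disj \<phi> \<psi>) (y @ z) (a \<eta>)) ` X)"
      using cons[OF X(2)] X(1) unfolding consistent_in_image by blast
    then have "b \<in> ?W" by (simp add: realises_def)
    moreover have "sat M (assign (assign ?u (y @ z) (a \<eta>)) x b) (Disj \<phi> \<psi>)" if "\<eta> \<in> X" for \<eta>
      using b that by (auto simp: realises_def inst_def)
    ultimately show "\<exists>b\<in>?W. \<forall>\<eta>\<in>X. A b \<eta> \<or> B b \<eta>" using disj by blast
  qed
  then obtain f where f: "tree_embedding f"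
    and AB: "full ?W (\<lambda>b \<eta>. A b (f \<eta>)) \<or> full ?W (\<lambda>b \<eta>. B b (f \<eta>))"
    using antichain_dichotomy by blast
  \<comment> \<open>Either disjunct at a node yields the disjunction there, and \<open>f\<close>
    keeps the two nodes comparable. This serves \<phi> and \<psi> alike.\<close>
  have clash: False if "strict_prefix \<eta> \<nu>" "b \<in> ?W"
    and "A b (f \<eta>) \<or> B b (f \<eta>)" "A b (f \<nu>) \<or> B b (f \<nu>)" for \<eta> \<nu> b
  proof -
    have "realises M x b {inst (Disj \<phi> \<psi>) (y @ z) (a (f \<eta>)), inst (Disj \<phi> \<psi>) (y @ z) (a (f \<nu>))}"
      using that(2) disj[OF that(2), of "f \<eta>"] disj[OF that(2), of "f \<nu>"] that(3,4)
      by (simp add: realises_def inst_def)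
    moreover have "strict_prefix (f \<eta>) (f \<nu>)" using f that(1) by (simp add: tree_embedding_def)
    ultimately show False using inc by (simp add: consistent_in_finite)
  qed
  from AB show ?thesis
  proof
    assume "full ?W (\<lambda>b \<eta>. A b (f \<eta>))"
    then have "witnesses_ATP M \<phi> x y"
    proof (intro witnesses_ATPI[of "p \<circ> f"])
      fix \<eta> \<nu> :: "bool list" and b assume sp: "strict_prefix \<eta> \<nu>"
      show "\<not> realises M x b {inst \<phi> y ((p \<circ> f) \<eta>), inst \<phi> y ((p \<circ> f) \<nu>)}"
      proof
        assume "realises M x b {inst \<phi> y ((p \<circ> f) \<eta>), inst \<phi> y ((p \<circ> f) \<nu>)}"
        then have "b \<in> ?W" "A b (f \<eta>)" "A b (f \<nu>)"
          by (simp_all add: realises_def inst_def A_def)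
        with clash[OF sp] show False by blast
      qed
    qed (simp_all add: p A_def)
    then show ?thesis ..
  next
    assume "full ?W (\<lambda>b \<eta>. B b (f \<eta>))"
    then have "witnesses_ATP M \<psi> x z"
    proof (intro witnesses_ATPI[of "q \<circ> f"])
      fix \<eta> \<nu> :: "bool list" and b assume sp: "strict_prefix \<eta> \<nu>"
      show "\<not> realises M x b {inst \<psi> z ((q \<circ> f) \<eta>), inst \<psi> z ((q \<circ> f) \<nu>)}"
      proof
        assume "realises M x b {inst \<psi> z ((q \<circ> f) \<eta>), inst \<psi> z ((q \<circ> f) \<nu>)}"
        then have "b \<in> ?W" "B b (f \<eta>)" "B b (f \<nu>)"
          by (simp_all add: realises_def inst_def B_def)
        with clash[OF sp] show False by blast
      qed
    qed (simp_all add: q B_def)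
    then show ?thesis ..
  qed
qed

end
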